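(* There exists a Hilbert holomorphic function space $H$ on $\mathbb{D}$ such that: (1) $H$ contains the polynomials; (2) the polynomials are dense in $H$; (3) the odd polynomials are not dense in the set of odd functions in $H$ (with respect to the norm of $H$). Moreover, given any sequence $(\omega_n)_{n\ge 0}$ of positive real numbers such that $\sum_{n} 1/\omega_n<\infty$, the space $H$ satisfying (1)--(3) can be chosen so that $\|z^n\|_H\le 1+\omega_n$ for all $n\ge 0$.
   Context: $\mathbb{D}$ denotes the open unit disk in $\mathbb{C}$, and $\mathrm{Hol}(\mathbb{D})$ the Fréchet space of holomorphic functions on $\mathbb{D}$ with the topology of uniform convergence on compact sets. A Hilbert holomorphic function space on $\mathbb{D}$ is a (complex) Hilbert space $H$ that is a subset (linear subspace) of $\mathrm{Hol}(\mathbb{D})$ such that the inclusion map $H\hookrightarrow\mathrm{Hol}(\mathbb{D})$ is continuous. A function $f$ on $\mathbb{D}$ is odd if $f(-z)=-f(z)$ for all $z\in\mathbb{D}$. Polynomials are polynomials in $z$ with complex coefficients, regarded as functions on $\mathbb{D}$; $z^n$ denotes the function $z\mapsto z^n$. *)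

theory Defs
  imports "HOL-Complex_Analysis.Complex_Analysis"
begin

text \<open>A function on the open unit disc is represented by its extension by 0 to the whole
  complex plane, so that two such functions are equal iff they agree on the disc.\<close>

definition on_disc :: "(complex \<Rightarrow> complex) \<Rightarrow> complex \<Rightarrow> complex" where
  "on_disc f = (\<lambda>z. if z \<in> ball 0 1 then f z else 0)"

definition Hol_disc :: "(complex \<Rightarrow> complex) set" where
  "Hol_disc = {f. f holomorphic_on ball 0 1 \<and> (\<forall>z. z \<notin> ball 0 1 \<longrightarrow> f z = 0)}"

text \<open>Uniform convergence on compact sets. Continuous functions attain their maximum on a compact
  set, so each generating set is open in that topology; the case of empty \<open>K\<close> makes
  \<open>Hol_disc\<close> the whole space.\<close>

definition Hol_disc_topology :: "(complex \<Rightarrow> complex) topology" where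
  "Hol_disc_topology = topology_generated_by
     {{g \<in> Hol_disc. \<forall>z\<in>K. dist (g z) (f z) < e} | f K e.
        f \<in> Hol_disc \<and> compact K \<and> K \<subseteq> ball 0 1 \<and> (0::real) < e}"

definition ip_norm :: "(('a \<Rightarrow> complex) \<Rightarrow> ('a \<Rightarrow> complex) \<Rightarrow> complex) \<Rightarrow> ('a \<Rightarrow> complex) \<Rightarrow> real" where
  "ip_norm ip f = sqrt (Re (ip f f))"

text \<open>The value off \<open>H\<close> is irrelevant; it is fixed because the locale \<open>Metric_space\<close>
  demands symmetry and nonnegativity on the whole type.\<close>

definition ip_dist ::
  "('a \<Rightarrow> complex) set \<Rightarrow> (('a \<Rightarrow> complex) \<Rightarrow> ('a \<Rightarrow> complex) \<Rightarrow> complex)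
     \<Rightarrow> ('a \<Rightarrow> complex) \<Rightarrow> ('a \<Rightarrow> complex) \<Rightarrow> real" where
  "ip_dist H ip f g = (if f \<in> H \<and> g \<in> H then ip_norm ip (\<lambda>z. f z - g z) else 0)"

locale inner_product_fun_space =
  fixes H :: "('a \<Rightarrow> complex) set"
    and ip :: "('a \<Rightarrow> complex) \<Rightarrow> ('a \<Rightarrow> complex) \<Rightarrow> complex"
  assumes zero_mem: "(\<lambda>z. 0) \<in> H"
    and add_mem: "\<And>f g. f \<in> H \<Longrightarrow> g \<in> H \<Longrightarrow> (\<lambda>z. f z + g z) \<in> H"
    and scale_mem: "\<And>c f. f \<in> H \<Longrightarrow> (\<lambda>z. c * f z) \<in> H"
    and ip_add: "\<And>f g h. f \<in> H \<Longrightarrow> g \<in> H \<Longrightarrow> h \<in> H \<Longrightarrow> ip (\<lambda>z. f z + g z) h = ip f h + ip g h"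
    and ip_scale: "\<And>c f g. f \<in> H \<Longrightarrow> g \<in> H \<Longrightarrow> ip (\<lambda>z. c * f z) g = c * ip f g"
    and ip_sym: "\<And>f g. f \<in> H \<Longrightarrow> g \<in> H \<Longrightarrow> ip g f = cnj (ip f g)"
    and ip_pos: "\<And>f. f \<in> H \<Longrightarrow> f \<noteq> (\<lambda>z. 0) \<Longrightarrow> 0 < Re (ip f f)"
begin

lemma diff_mem:
  assumes "f \<in> H" "g \<in> H" shows "(\<lambda>z. f z - g z) \<in> H"
  using add_mem[OF assms(1) scale_mem[OF assms(2), of "-1"]] by simp

lemma ip_zero: "f \<in> H \<Longrightarrow> ip (\<lambda>z. 0) f = 0"
  using ip_scale[of f f 0] by simp

lemma ip_nonneg: "f \<in> H \<Longrightarrow> 0 \<le> Re (ip f f)"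
  by (cases "f = (\<lambda>z. 0)") (auto simp: ip_zero zero_mem dest: ip_pos)

lemma ip_self: "f \<in> H \<Longrightarrow> ip f f = of_real (Re (ip f f))"
  using ip_sym[of f f] by (simp add: complex_eq_iff)

lemma ip_add_right:
  "f \<in> H \<Longrightarrow> g \<in> H \<Longrightarrow> h \<in> H \<Longrightarrow> ip h (\<lambda>z. f z + g z) = ip h f + ip h g"
  using ip_sym[of "\<lambda>z. f z + g z" h] ip_sym[of f h] ip_sym[of g h] by (simp add: add_mem ip_add)

lemma ip_scale_right: "f \<in> H \<Longrightarrow> g \<in> H \<Longrightarrow> ip g (\<lambda>z. c * f z) = cnj c * ip g f"
  using ip_sym[of "\<lambda>z. c * f z" g] ip_sym[of f g] by (simp add: scale_mem ip_scale)

lemma ip_expand: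
  assumes "f \<in> H" "g \<in> H"
  shows "Re (ip (\<lambda>z. f z + of_real t * g z) (\<lambda>z. f z + of_real t * g z))
           = Re (ip f f) + 2 * t * Re (ip f g) + t\<^sup>2 * Re (ip g g)"
  using assms ip_sym[OF assms]
  by (simp add: add_mem scale_mem ip_add ip_add_right ip_scale ip_scale_right power2_eq_square algebra_simps)

lemma ip_Cauchy_Schwarz:
  assumes f: "f \<in> H" and g: "g \<in> H"
  shows "Re (ip f g) \<le> ip_norm ip f * ip_norm ip g"
proof (cases "g = (\<lambda>z. 0)")
  case True
  then show ?thesis
    using ip_sym[OF f g] by (simp add: f ip_zero ip_norm_def zero_mem)
next
  case False
  define a b c where "a = Re (ip f f)" and "b = Re (ip f g)" and "c = Re (ip g g)"
  have c: "c > 0" using ip_pos[OF g False] by (simp add: c_def)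
  have "0 \<le> a + 2 * (-b/c) * b + (-b/c)\<^sup>2 * c"
    using ip_nonneg[OF add_mem[OF f scale_mem[OF g, of "of_real (-b/c)"]]]
    by (simp only: ip_expand[OF f g] a_def b_def c_def)
  then have "b\<^sup>2 \<le> a * c"
    using c by (simp add: power2_eq_square field_simps)
  then have "b \<le> sqrt (a * c)"
    by (rule real_le_rsqrt)
  then show ?thesis by (simp add: ip_norm_def a_def b_def c_def real_sqrt_mult)
qed

lemma ip_norm_triangle:
  assumes f: "f \<in> H" and g: "g \<in> H"
  shows "ip_norm ip (\<lambda>z. f z + g z) \<le> ip_norm ip f + ip_norm ip g"
proof -
  have "Re (ip (\<lambda>z. f z + g z) (\<lambda>z. f z + g z)) = Re (ip f f) + 2 * Re (ip f g) + Re (ip g g)"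
    using ip_expand[OF f g, of 1] by simp
  also have "\<dots> \<le> (ip_norm ip f + ip_norm ip g)\<^sup>2"
    using ip_Cauchy_Schwarz[OF f g] by (simp add: ip_norm_def power2_sum ip_nonneg f g)
  finally show ?thesis
    by (simp add: ip_norm_def real_le_lsqrt ip_nonneg f g)
qed

lemma ip_norm_minus:
  assumes "f \<in> H" "g \<in> H"
  shows "ip_norm ip (\<lambda>z. f z - g z) = ip_norm ip (\<lambda>z. g z - f z)"
  using ip_scale[OF diff_mem[OF assms] scale_mem[OF diff_mem[OF assms], of "-1"], of "-1"]
    ip_scale_right[OF diff_mem[OF assms] diff_mem[OF assms], of "-1"]
  by (simp add: ip_norm_def)

sublocale Metric_space H "ip_dist H ip"
proof
  show "0 \<le> ip_dist H ip f g" for f g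
    by (simp add: ip_dist_def ip_norm_def ip_nonneg diff_mem)
  show "ip_dist H ip f g = ip_dist H ip g f" for f g
    using ip_norm_minus by (auto simp: ip_dist_def)
  show "ip_dist H ip f g = 0 \<longleftrightarrow> f = g" if "f \<in> H" "g \<in> H" for f g
  proof -
    have "(\<lambda>z. f z - g z) = (\<lambda>z. 0) \<longleftrightarrow> f = g"
      by (simp add: fun_eq_iff)
    then show ?thesis
      using ip_pos[OF diff_mem[OF that]]
      by (auto simp: ip_dist_def ip_norm_def that ip_zero zero_mem)
  qed
  show "ip_dist H ip f h \<le> ip_dist H ip f g + ip_dist H ip g h" if "f \<in> H" "g \<in> H" "h \<in> H" for f g h
    using ip_norm_triangle[OF diff_mem[OF that(1,2)] diff_mem[OF that(2,3)]]
    by (simp add: ip_dist_def that)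
qed

end

locale hilbert_hol_space = inner_product_fun_space H ip
  for H :: "(complex \<Rightarrow> complex) set"
    and ip :: "(complex \<Rightarrow> complex) \<Rightarrow> (complex \<Rightarrow> complex) \<Rightarrow> complex" +
  assumes complete: mcomplete
    and subset_Hol: "H \<subseteq> Hol_disc"
    and inclusion_continuous: "continuous_map mtopology Hol_disc_topology (\<lambda>f. f)"

definition ip_dense_in ::
  "('a \<Rightarrow> complex) set \<Rightarrow> (('a \<Rightarrow> complex) \<Rightarrow> ('a \<Rightarrow> complex) \<Rightarrow> complex)
     \<Rightarrow> ('a \<Rightarrow> complex) set \<Rightarrow> ('a \<Rightarrow> complex) set \<Rightarrow> bool" where
  "ip_dense_in H ip A S \<longleftrightarrow> S \<subseteq> Metric_space.mtopology H (ip_dist H ip) closure_of A"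

definition disc_polynomials :: "(complex \<Rightarrow> complex) set" where
  "disc_polynomials = range (\<lambda>p. on_disc (poly p))"

definition odd_on_disc :: "(complex \<Rightarrow> complex) \<Rightarrow> bool" where
  "odd_on_disc f \<longleftrightarrow> (\<forall>z\<in>ball 0 1. f (- z) = - f z)"

end

theory Submission
  imports Defs
begin

text \<open>The space is the image of \<open>\<ell>\<^sup>2\<close> under an injective map that sends a vector
  \<open>x = (t, x\<^sub>1, x\<^sub>2, \<dots>)\<close> to a power series whose \<open>n\<close>-th coefficient is \<open>x\<^sub>n\<^sub>+\<^sub>1\<close> for even \<open>n\<close>
  and \<open>x\<^sub>n\<^sub>+\<^sub>1 + t - \<Sum>\<^sub>i\<^sub><\<^sub>n \<beta>\<^sub>i x\<^sub>i\<^sub>+\<^sub>1\<close> for odd \<open>n\<close>. The real weights \<open>\<beta>\<close> vanish at odd indices and are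
  bounded but not square summable. In terms of a function \<open>f = \<Sum> f\<^sub>n z\<^sup>n\<close> the coordinate \<open>t\<close> is the
  limit, along odd \<open>n\<close>, of \<open>f\<^sub>n + \<Sum>\<^sub>i\<^sub><\<^sub>n \<beta>\<^sub>i f\<^sub>i\<close>. It is continuous by construction and vanishes on odd
  polynomials, but equals 1 at the odd function \<open>z / (1 - z\<^sup>2)\<close>, which is the image of
  \<open>(1, 0, 0, \<dots>)\<close>. Even monomials, on the other hand, have \<open>t = \<beta>\<^sub>n\<close>, and since \<open>\<beta>\<close> is not square
  summable, no nonzero vector is orthogonal to all polynomials. Finally
  \<open>\<parallel>z\<^sup>n\<parallel>\<^sup>2 \<le> 1 + (n + 1) \<beta>\<^sub>n\<^sup>2\<close>, which is at most \<open>(1 + \<delta>)\<^sup>2\<close> for \<open>\<beta>\<^sub>n = \<delta> / \<surd>(n + 1)\<close>, where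
  \<open>\<delta>\<close> is a positive lower bound of the sequence \<open>\<omega>\<close>.\<close>

section \<open>The Hilbert space of square summable sequences\<close>

definition square_summable :: "(nat \<Rightarrow> complex) set" where
  "square_summable = {x. summable (\<lambda>n. (cmod (x n))\<^sup>2)}"

definition l2_ip :: "(nat \<Rightarrow> complex) \<Rightarrow> (nat \<Rightarrow> complex) \<Rightarrow> complex" where
  "l2_ip x y = (\<Sum>n. x n * cnj (y n))"

lemma norm_add_square_le:
  fixes a b :: "'a :: real_normed_vector"
  shows "(norm (a + b))\<^sup>2 \<le> 2 * (norm a)\<^sup>2 + 2 * (norm b)\<^sup>2"
proof -
  have "(norm (a + b))\<^sup>2 \<le> (norm a + norm b)\<^sup>2"
    by (intro power_mono norm_triangle_ineq) simp
  also have "\<dots> \<le> 2 * (norm a)\<^sup>2 + 2 * (norm b)\<^sup>2"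
    using sum_squares_bound[of "norm a" "norm b"] by (simp add: power2_sum)
  finally show ?thesis .
qed

lemma square_summable_add:
  assumes "x \<in> square_summable" "y \<in> square_summable"
  shows "(\<lambda>n. x n + y n) \<in> square_summable"
proof -
  have "summable (\<lambda>n. 2 * (cmod (x n))\<^sup>2 + 2 * (cmod (y n))\<^sup>2)"
    using assms by (intro summable_add summable_mult) (auto simp: square_summable_def)
  then have "summable (\<lambda>n. (cmod (x n + y n))\<^sup>2)"
    by (rule summable_comparison_test[rotated]) (auto intro!: exI[of _ 0] norm_add_square_le)
  then show ?thesis by (simp add: square_summable_def)
qed

lemma square_summable_scale:
  "x \<in> square_summable \<Longrightarrow> (\<lambda>n. c * x n) \<in> square_summable"
  by (simp add: square_summable_def norm_mult power_mult_distrib summable_mult)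

lemma square_summable_finite:
  assumes "finite A" "\<And>n. n \<notin> A \<Longrightarrow> x n = 0"
  shows "x \<in> square_summable"
  using assms by (auto simp: square_summable_def intro: summable_finite)

lemma summable_l2_ip:
  assumes "x \<in> square_summable" "y \<in> square_summable"
  shows "summable (\<lambda>n. x n * cnj (y n))"
proof (rule summable_comparison_test)
  show "summable (\<lambda>n. (cmod (x n))\<^sup>2 + (cmod (y n))\<^sup>2)"
    using assms by (auto simp: square_summable_def intro: summable_add)
  have "cmod (x n * cnj (y n)) \<le> (cmod (x n))\<^sup>2 + (cmod (y n))\<^sup>2" for n
  proof -
    have "0 \<le> cmod (x n) * cmod (y n)" by simp
    with sum_squares_bound[of "cmod (x n)" "cmod (y n)"] show ?thesis
      unfolding norm_mult complex_mod_cnj by linarith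
  qed
  then show "\<exists>N. \<forall>n\<ge>N. norm (x n * cnj (y n)) \<le> (cmod (x n))\<^sup>2 + (cmod (y n))\<^sup>2"
    by blast
qed

lemma l2_ip_self: "l2_ip x x = of_real (\<Sum>n. (cmod (x n))\<^sup>2)" if "x \<in> square_summable"
  using that unfolding l2_ip_def square_summable_def complex_norm_square[symmetric]
  by (simp only: suminf_of_real mem_Collect_eq of_real_power[symmetric])

interpretation l2: inner_product_fun_space square_summable l2_ip
proof
  show "(\<lambda>n. 0) \<in> square_summable" by (simp add: square_summable_def)
  show "l2_ip (\<lambda>z. f z + g z) h = l2_ip f h + l2_ip g h"
    if "f \<in> square_summable" "g \<in> square_summable" "h \<in> square_summable" for f g h
    using that by (simp add: l2_ip_def distrib_right suminf_add summable_l2_ip)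
  show "l2_ip (\<lambda>z. c * f z) g = c * l2_ip f g"
    if "f \<in> square_summable" "g \<in> square_summable" for c f g
    using that by (simp add: l2_ip_def mult.assoc suminf_mult summable_l2_ip)
  show "l2_ip g f = cnj (l2_ip f g)"
    if "f \<in> square_summable" "g \<in> square_summable" for f g
  proof -
    have "(\<lambda>n. cnj (f n * cnj (g n))) sums cnj (l2_ip f g)"
      unfolding sums_cnj l2_ip_def using summable_l2_ip[OF that] by (rule summable_sums)
    then have "(\<lambda>n. g n * cnj (f n)) sums cnj (l2_ip f g)"
      by (simp add: mult.commute)
    then show ?thesis by (simp add: l2_ip_def sums_iff)
  qed
  show "0 < Re (l2_ip f f)" if f: "f \<in> square_summable" "f \<noteq> (\<lambda>z. 0)" for f
  proof -
    obtain n where "f n \<noteq> 0" using f(2) by auto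
    then have "0 < (\<Sum>n. (cmod (f n))\<^sup>2)"
      using f(1) by (intro suminf_pos2[where i = n]) (auto simp: square_summable_def)
    then show ?thesis by (simp add: l2_ip_self f(1))
  qed
qed (auto intro: square_summable_add square_summable_scale)

lemma l2_norm: "x \<in> square_summable \<Longrightarrow> ip_norm l2_ip x = sqrt (\<Sum>n. (cmod (x n))\<^sup>2)"
  by (simp add: ip_norm_def l2_ip_self)

lemma sum_le_l2_norm:
  assumes "x \<in> square_summable" "finite A"
  shows "(\<Sum>n\<in>A. (cmod (x n))\<^sup>2) \<le> (ip_norm l2_ip x)\<^sup>2"
proof -
  have "(\<Sum>n\<in>A. (cmod (x n))\<^sup>2) \<le> (\<Sum>n. (cmod (x n))\<^sup>2)"
    using assms by (intro sum_le_suminf) (auto simp: square_summable_def)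
  moreover have "0 \<le> (\<Sum>n. (cmod (x n))\<^sup>2)"
    using assms by (intro suminf_nonneg) (auto simp: square_summable_def)
  ultimately show ?thesis by (simp add: l2_norm assms(1))
qed

lemma ip_norm_l2_nonneg: "x \<in> square_summable \<Longrightarrow> 0 \<le> ip_norm l2_ip x"
  by (simp add: ip_norm_def l2.ip_nonneg)

lemma cmod_le_l2_norm: "x \<in> square_summable \<Longrightarrow> cmod (x n) \<le> ip_norm l2_ip x"
  using sum_le_l2_norm[of x "{n}"] by (auto intro: power2_le_imp_le simp: ip_norm_l2_nonneg)

lemma l2_norm_finite:
  assumes "finite A" "\<And>n. n \<notin> A \<Longrightarrow> x n = 0"
  shows "ip_norm l2_ip x = sqrt (\<Sum>n\<in>A. (cmod (x n))\<^sup>2)"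
  using assms by (simp add: l2_norm square_summable_finite suminf_finite[of A])

text \<open>Square summability and the norm bound both follow from uniform bounds on finite partial
  sums; such bounds survive coordinatewise limits, which is how completeness uses them.\<close>

lemma square_summable_bounded:
  assumes "\<And>N. (\<Sum>n<N. (cmod (x n))\<^sup>2) \<le> b\<^sup>2" "0 \<le> b"
  shows "x \<in> square_summable" "ip_norm l2_ip x \<le> b"
proof -
  have "summable (\<lambda>n. (cmod (x n))\<^sup>2)"
    by (rule summableI_nonneg_bounded) (use assms(1) in auto)
  then show x: "x \<in> square_summable"
    by (simp add: square_summable_def)
  have "(\<Sum>n. (cmod (x n))\<^sup>2) \<le> b\<^sup>2"
    by (rule suminf_le_const) (use assms x in \<open>auto simp: square_summable_def\<close>)
  then show "ip_norm l2_ip x \<le> b"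
    using x assms(2) by (simp add: l2_norm real_le_lsqrt)
qed

text \<open>Coordinates are dominated by the norm, so a Cauchy sequence converges coordinatewise.
  The Cauchy estimate then passes to the limit on each finite block of coordinates.\<close>

lemma l2_complete: "l2.mcomplete"
  unfolding l2.mcomplete_def
proof (intro allI impI)
  fix \<sigma> :: "nat \<Rightarrow> nat \<Rightarrow> complex"
  assume C: "l2.MCauchy \<sigma>"
  then have \<sigma>: "\<sigma> m \<in> square_summable" for m
    by (auto simp: l2.MCauchy_def)
  have C': "\<exists>N. \<forall>m k. N \<le> m \<longrightarrow> N \<le> k \<longrightarrow> ip_norm l2_ip (\<lambda>n. \<sigma> m n - \<sigma> k n) < e" if "e > 0" for e
    using C that by (auto simp: l2.MCauchy_def ip_dist_def \<sigma>)
  have "Cauchy (\<lambda>m. \<sigma> m n)" for n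
  proof (rule metric_CauchyI)
    fix e :: real assume "0 < e"
    then obtain N where N: "\<forall>m k. N \<le> m \<longrightarrow> N \<le> k \<longrightarrow> ip_norm l2_ip (\<lambda>n. \<sigma> m n - \<sigma> k n) < e"
      using C' by blast
    have "dist (\<sigma> m n) (\<sigma> k n) < e" if "m \<ge> N" "k \<ge> N" for m k
      using cmod_le_l2_norm[OF l2.diff_mem[OF \<sigma>[of m] \<sigma>[of k]], of n] N that
      by (fastforce simp: dist_norm)
    then show "\<exists>M. \<forall>m\<ge>M. \<forall>k\<ge>M. dist (\<sigma> m n) (\<sigma> k n) < e" by blast
  qed
  then have "\<forall>n. \<exists>l. (\<lambda>m. \<sigma> m n) \<longlonglongrightarrow> l"
    by (auto intro: Cauchy_convergent simp: convergent_def[symmetric])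
  then obtain y where y: "\<And>n. (\<lambda>m. \<sigma> m n) \<longlonglongrightarrow> y n"
    by metis
  have lim: "\<exists>N. \<forall>m\<ge>N. (\<lambda>n. \<sigma> m n - y n) \<in> square_summable \<and> ip_norm l2_ip (\<lambda>n. \<sigma> m n - y n) \<le> e"
    if "e > 0" for e
  proof -
    obtain N where N: "\<forall>m k. N \<le> m \<longrightarrow> N \<le> k \<longrightarrow> ip_norm l2_ip (\<lambda>n. \<sigma> m n - \<sigma> k n) < e"
      using C' \<open>e > 0\<close> by blast
    \<comment> \<open>The length \<open>L\<close> is fixed before \<open>k\<close> tends to
      infinity, so only a finite sum has to commute with the limit.\<close>
    have b: "(\<Sum>n<L. (cmod (\<sigma> m n - y n))\<^sup>2) \<le> e\<^sup>2" if "m \<ge> N" for m L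
    proof (rule LIMSEQ_le_const2)
      show "(\<lambda>k. \<Sum>n<L. (cmod (\<sigma> m n - \<sigma> k n))\<^sup>2) \<longlonglongrightarrow> (\<Sum>n<L. (cmod (\<sigma> m n - y n))\<^sup>2)"
        by (intro tendsto_intros y)
      have "(\<Sum>n<L. (cmod (\<sigma> m n - \<sigma> k n))\<^sup>2) \<le> e\<^sup>2" if "k \<ge> N" for k
      proof -
        have d: "(\<lambda>n. \<sigma> m n - \<sigma> k n) \<in> square_summable"
          by (rule l2.diff_mem) (rule \<sigma>)+
        then have "(\<Sum>n<L. (cmod (\<sigma> m n - \<sigma> k n))\<^sup>2) \<le> (ip_norm l2_ip (\<lambda>n. \<sigma> m n - \<sigma> k n))\<^sup>2"
          by (rule sum_le_l2_norm) simp
        also have "\<dots> \<le> e\<^sup>2"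
          using N \<open>m \<ge> N\<close> \<open>k \<ge> N\<close> ip_norm_l2_nonneg[OF d] by (intro power_mono) (auto simp: less_imp_le)
        finally show ?thesis .
      qed
      then show "\<exists>M. \<forall>k\<ge>M. (\<Sum>n<L. (cmod (\<sigma> m n - \<sigma> k n))\<^sup>2) \<le> e\<^sup>2" by blast
    qed
    then show ?thesis
      using square_summable_bounded[of "\<lambda>n. \<sigma> _ n - y n" e] \<open>e > 0\<close> by (meson less_imp_le)
  qed
  \<comment> \<open>The limit \<open>y\<close> is the difference of \<open>\<sigma> m\<close> and
    \<open>\<sigma> m - y\<close>, hence itself square summable.\<close>
  obtain m where "(\<lambda>n. \<sigma> m n - y n) \<in> square_summable"
    using lim[of 1] by auto
  from l2.diff_mem[OF \<sigma>[of m] this] have ys: "y \<in> square_summable" by simp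
  have "\<exists>N. \<forall>m\<ge>N. \<sigma> m \<in> square_summable \<and> ip_dist square_summable l2_ip (\<sigma> m) y < e" if "e > 0" for e
    using lim[of "e / 2"] that by (force simp: ip_dist_def \<sigma> ys)
  then have "limitin l2.mtopology \<sigma> y sequentially"
    by (auto simp: l2.limitin_metric ys eventually_sequentially)
  then show "\<exists>x. limitin l2.mtopology \<sigma> x sequentially" by blast
qed

section \<open>Transport of a Hilbert space structure into the holomorphic functions\<close>

text \<open>By linearity, \<open>T_kernel\<close> amounts to injectivity and \<open>T_bound\<close>
  to continuity for uniform convergence on compact sets. The range of such a \<open>T\<close>, with
  the structure carried over, is a Hilbert holomorphic function space.\<close>

locale hol_embedding = inner_product_fun_space E ip
  for E :: "('a \<Rightarrow> complex) set" and ip +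
  fixes T :: "('a \<Rightarrow> complex) \<Rightarrow> complex \<Rightarrow> complex"
  assumes complete: mcomplete
    and T_Hol: "\<And>x. x \<in> E \<Longrightarrow> T x \<in> Hol_disc"
    and T_add: "\<And>x y. x \<in> E \<Longrightarrow> y \<in> E \<Longrightarrow> T (\<lambda>i. x i + y i) = (\<lambda>z. T x z + T y z)"
    and T_scale: "\<And>c x. x \<in> E \<Longrightarrow> T (\<lambda>i. c * x i) = (\<lambda>z. c * T x z)"
    and T_kernel: "\<And>x. x \<in> E \<Longrightarrow> T x = (\<lambda>z. 0) \<Longrightarrow> x = (\<lambda>i. 0)"
    and T_bound: "\<And>K. compact K \<Longrightarrow> K \<subseteq> ball 0 1 \<Longrightarrow> \<exists>C. \<forall>x\<in>E. \<forall>z\<in>K. cmod (T x z) \<le> C * ip_norm ip x"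
begin

text \<open>This choice makes \<open>T\<close> an isometry of \<open>E\<close> onto its range, so
  that norms, distances and completeness can be computed in \<open>E\<close>.\<close>

definition image_ip :: "(complex \<Rightarrow> complex) \<Rightarrow> (complex \<Rightarrow> complex) \<Rightarrow> complex" where
  "image_ip f g = ip (inv_into E T f) (inv_into E T g)"

lemma T_diff: "x \<in> E \<Longrightarrow> y \<in> E \<Longrightarrow> T (\<lambda>i. x i - y i) = (\<lambda>z. T x z - T y z)"
  using T_add[of x "\<lambda>i. -1 * y i"] T_scale[of y "-1"] scale_mem[of y "-1"] by simp

lemma inj_T: "inj_on T E"
proof (rule inj_onI)
  fix x y assume xy: "x \<in> E" "y \<in> E" "T x = T y"
  then have "(\<lambda>i. x i - y i) = (\<lambda>i. 0)"
    by (intro T_kernel diff_mem) (simp_all add: T_diff)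
  then show "x = y" by (simp add: fun_eq_iff)
qed

lemma inv_T: "x \<in> E \<Longrightarrow> inv_into E T (T x) = x"
  by (simp add: inj_T)

lemma image_ip_T: "x \<in> E \<Longrightarrow> y \<in> E \<Longrightarrow> image_ip (T x) (T y) = ip x y"
  by (simp add: image_ip_def inv_T)

lemma image_norm_T: "x \<in> E \<Longrightarrow> ip_norm image_ip (T x) = ip_norm ip x"
  by (simp add: ip_norm_def image_ip_T)

lemma image_dist_T: "x \<in> E \<Longrightarrow> y \<in> E \<Longrightarrow> ip_dist (T ` E) image_ip (T x) (T y) = ip_dist E ip x y"
  using image_norm_T[OF diff_mem, of x y] by (simp add: ip_dist_def T_diff)

lemma T_zero: "T (\<lambda>i. 0) = (\<lambda>z. 0)"
  using T_scale[OF zero_mem, of 0] by simp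

lemma image_inner_product: "inner_product_fun_space (T ` E) image_ip"
proof
  show "(\<lambda>z. 0) \<in> T ` E"
    using imageI[OF zero_mem, of T] by (simp only: T_zero)
  show "(\<lambda>z. f z + g z) \<in> T ` E" if "f \<in> T ` E" "g \<in> T ` E" for f g
    using that by (auto simp: T_add[symmetric] add_mem)
  show "(\<lambda>z. c * f z) \<in> T ` E" if "f \<in> T ` E" for c f
    using that by (auto simp: T_scale[symmetric] scale_mem)
  show "image_ip (\<lambda>z. f z + g z) h = image_ip f h + image_ip g h"
    if "f \<in> T ` E" "g \<in> T ` E" "h \<in> T ` E" for f g h
    using that by (auto simp: T_add[symmetric] add_mem image_ip_T ip_add)
  show "image_ip (\<lambda>z. c * f z) g = c * image_ip f g" if "f \<in> T ` E" "g \<in> T ` E" for c f g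
    using that by (auto simp: T_scale[symmetric] scale_mem image_ip_T ip_scale)
  show "image_ip g f = cnj (image_ip f g)" if "f \<in> T ` E" "g \<in> T ` E" for f g
    using that by (auto simp: image_ip_T intro: ip_sym)
  show "0 < Re (image_ip f f)" if "f \<in> T ` E" "f \<noteq> (\<lambda>z. 0)" for f
    using that T_zero by (auto simp: image_ip_T intro!: ip_pos)
qed

sublocale image: inner_product_fun_space "T ` E" image_ip
  by (rule image_inner_product)

lemma image_complete: "image.mcomplete"
  unfolding image.mcomplete_def
proof (intro allI impI)
  fix \<sigma> assume C: "image.MCauchy \<sigma>"
  then have "\<sigma> n \<in> T ` E" for n
    unfolding image.MCauchy_def by blast
  then obtain \<tau> where \<tau>: "\<And>n. \<tau> n \<in> E" "\<And>n. \<sigma> n = T (\<tau> n)"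
    unfolding image_iff by metis
  have "MCauchy \<tau>"
    using C \<tau>(1) by (simp add: MCauchy_def image.MCauchy_def \<tau>(2) image_dist_T image_subset_iff)
  then obtain x where x: "limitin mtopology \<tau> x sequentially"
    using complete by (auto simp: mcomplete_def)
  then have "limitin image.mtopology \<sigma> (T x) sequentially"
    using \<tau>(1) by (simp add: limitin_metric image.limitin_metric \<tau>(2) image_dist_T)
  then show "\<exists>f. limitin image.mtopology \<sigma> f sequentially" by blast
qed

text \<open>It suffices to treat the generating sets. A member of one keeps a positive margin on
  \<open>K\<close>, and the estimate of \<open>T\<close> on \<open>K\<close> turns that margin into
  the radius of a ball.\<close>

lemma image_inclusion_continuous: "continuous_map image.mtopology Hol_disc_topology (\<lambda>f. f)"
  unfolding Hol_disc_topology_def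
proof (rule continuous_on_generated_topo)
  show "(\<lambda>f. f) ` topspace image.mtopology \<subseteq> \<Union> {{g \<in> Hol_disc. \<forall>z\<in>K. dist (g z) (f z) < e} | f K e.
        f \<in> Hol_disc \<and> compact K \<and> K \<subseteq> ball 0 1 \<and> (0::real) < e}"
  proof
    fix f assume "f \<in> (\<lambda>f. f) ` topspace image.mtopology"
    then have "f \<in> Hol_disc" using T_Hol by auto
    \<comment> \<open>The generating set with \<open>K\<close> empty is all of
      \<open>Hol_disc\<close>.\<close>
    then show "f \<in> \<Union> {{g \<in> Hol_disc. \<forall>z\<in>K. dist (g z) (f z) < e} | f K e.
        f \<in> Hol_disc \<and> compact K \<and> K \<subseteq> ball 0 1 \<and> (0::real) < e}"
      by (intro UnionI[of "{g \<in> Hol_disc. \<forall>z\<in>{}. dist (g z) (f z) < 1}"] CollectI exI[of _ f] exI[of _ "{}"] exI[of _ "1::real"]) auto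
  qed
next
  fix U assume "U \<in> {{g \<in> Hol_disc. \<forall>z\<in>K. dist (g z) (f z) < e} | f K e.
        f \<in> Hol_disc \<and> compact K \<and> K \<subseteq> ball 0 1 \<and> (0::real) < e}"
  then obtain f K e where U: "U = {g \<in> Hol_disc. \<forall>z\<in>K. dist (g z) (f z) < e}"
    and f: "f \<in> Hol_disc" and K: "compact K" "K \<subseteq> ball 0 1" and e: "0 < e" by blast
  obtain C0 where C0: "\<And>x z. x \<in> E \<Longrightarrow> z \<in> K \<Longrightarrow> cmod (T x z) \<le> C0 * ip_norm ip x"
    using T_bound[OF K] by blast
  \<comment> \<open>The constant is enlarged so that it is positive and can divide the
    margin.\<close>
  define C where "C = \<bar>C0\<bar> + 1"
  have C: "cmod (T x z) \<le> C * ip_norm ip x" if "x \<in> E" "z \<in> K" for x z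
  proof -
    have "C0 * ip_norm ip x \<le> C * ip_norm ip x"
      by (rule mult_right_mono) (simp_all add: C_def ip_norm_def ip_nonneg that(1))
    with C0[OF that] show ?thesis by linarith
  qed
  have "C > 0" by (simp add: C_def)
  have "\<exists>r>0. image.mball g r \<subseteq> U \<inter> T ` E" if g: "g \<in> U" "g \<in> T ` E" for g
  proof -
    \<comment> \<open>The continuous function \<open>dist (g z) (f z)\<close> attains its maximum on
      \<open>K\<close>, and that maximum is below \<open>e\<close>.\<close>
    have "\<exists>d>0. \<forall>z\<in>K. dist (g z) (f z) \<le> e - d"
    proof (cases "K = {}")
      case True
      then show ?thesis by (auto intro: exI[of _ 1])
    next
      case False
      have "continuous_on K f" "continuous_on K g"
        using f g(1) K(2) by (auto simp: U Hol_disc_def intro: continuous_on_subset holomorphic_on_imp_continuous_on)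
      then obtain w where "w \<in> K" "\<forall>z\<in>K. dist (g z) (f z) \<le> dist (g w) (f w)"
        using continuous_attains_sup[OF K(1) False, of "\<lambda>z. dist (g z) (f z)"]
        by (auto intro: continuous_intros)
      then show ?thesis
        using g(1) by (intro exI[of _ "e - dist (g w) (f w)"]) (auto simp: U)
    qed
    then obtain d where d: "d > 0" "\<And>z. z \<in> K \<Longrightarrow> dist (g z) (f z) \<le> e - d" by blast
    have "h \<in> U" if "h \<in> image.mball g (d / C)" for h
    proof -
      from that g obtain x y where xy: "x \<in> E" "g = T x" "y \<in> E" "h = T y" by (auto simp: image.in_mball)
      have "dist (h z) (f z) < e" if z: "z \<in> K" for z
      proof -
        have "ip_norm ip (\<lambda>i. x i - y i) < d / C"
          using \<open>h \<in> image.mball g (d / C)\<close> unfolding image.in_mball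
          by (simp only: xy image_dist_T) (simp add: ip_dist_def xy)
        then have "C * ip_norm ip (\<lambda>i. x i - y i) < d"
          using \<open>C > 0\<close> by (simp add: field_simps)
        with C[OF diff_mem[OF xy(1,3)] z] have "dist (g z) (h z) < d"
          using xy by (simp add: T_diff dist_norm)
        then show ?thesis
          using d(2)[OF z] dist_triangle3[of "h z" "f z" "g z"] by simp
      qed
      then show ?thesis using xy T_Hol by (simp add: U)
    qed
    then have "image.mball g (d / C) \<subseteq> U \<inter> T ` E"
      using image.mball_subset_mspace by blast
    then show ?thesis using \<open>C > 0\<close> d(1) by (intro exI[of _ "d / C"]) simp
  qed
  then show "openin image.mtopology ((\<lambda>f. f) -` U \<inter> topspace image.mtopology)"
    by (auto simp: image.openin_mtopology)
qed

lemma image_hilbert_hol_space: "hilbert_hol_space (T ` E) image_ip"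
  using image_complete image_inclusion_continuous T_Hol by unfold_locales auto

end

section \<open>Power series with twisted coefficients\<close>

text \<open>A series with a nonzero coefficient and zero constant term has no zeros in a small
  punctured disc, which is absurd for the zero function.\<close>

lemma powser_eq_zero:
  fixes a :: "nat \<Rightarrow> complex"
  assumes "\<And>z. cmod z < 1 \<Longrightarrow> (\<lambda>n. a n * z ^ n) sums 0"
  shows "a n = 0"
proof (rule ccontr)
  assume n: "a n \<noteq> 0"
  have "a 0 = 0" using assms[of 0] by simp
  with n have "n > 0" by (cases n) auto
  obtain s where s: "0 < s" "\<And>z::complex. z \<in> cball 0 s - {0} \<Longrightarrow> (0::complex) \<noteq> 0"
    by (rule powser_0_nonzero[of 1 0 a "\<lambda>z. 0", OF _ _ _ n \<open>n > 0\<close>]) (use assms in auto)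
  have "complex_of_real s \<in> cball 0 s - {0}" using s(1) by auto
  then show False using s(2) by blast
qed

locale gap_weights =
  fixes \<beta> :: "nat \<Rightarrow> real"
  assumes odd_zero: "odd i \<Longrightarrow> \<beta> i = 0"
    and le_one: "\<bar>\<beta> i\<bar> \<le> 1"
    and diverges: "\<not> summable (\<lambda>i. (\<beta> i)\<^sup>2)"
begin

definition twist :: "(nat \<Rightarrow> complex) \<Rightarrow> nat \<Rightarrow> complex" where
  "twist x n = x (Suc n) + (if odd n then x 0 - (\<Sum>i<n. of_real (\<beta> i) * x (Suc i)) else 0)"

definition twisted_series :: "(nat \<Rightarrow> complex) \<Rightarrow> complex \<Rightarrow> complex" where
  "twisted_series x = on_disc (\<lambda>z. \<Sum>n. twist x n * z ^ n)"

lemma twist_add: "twist (\<lambda>i. x i + y i) n = twist x n + twist y n"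
  by (simp add: twist_def algebra_simps sum.distrib)

lemma twist_scale: "twist (\<lambda>i. c * x i) n = c * twist x n"
  by (simp add: twist_def algebra_simps sum_distrib_left)

text \<open>Bounded weights and bounded coordinates make the coefficients grow at most linearly,
  which is enough for convergence in the whole disc.\<close>

lemma twist_bound:
  assumes x: "x \<in> square_summable"
  shows "cmod (twist x n) \<le> 2 * ip_norm l2_ip x * real (Suc n)"
proof -
  define N where "N = ip_norm l2_ip x"
  have N: "cmod (x i) \<le> N" for i
    unfolding N_def by (rule cmod_le_l2_norm[OF x])
  then have "N \<ge> 0" using norm_ge_zero[of "x 0"] order_trans by blast
  have t: "cmod (of_real (\<beta> i) * x (Suc i)) \<le> N" for i
    using mult_mono[OF le_one[of i] N[of "Suc i"]] by (simp add: norm_mult)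
  have "cmod (\<Sum>i<n. of_real (\<beta> i) * x (Suc i)) \<le> real n * N"
    using sum_norm_le[of "{..<n}" "\<lambda>i. of_real (\<beta> i) * x (Suc i)" "\<lambda>_. N"] t by simp
  then have "cmod (x 0 - (\<Sum>i<n. of_real (\<beta> i) * x (Suc i))) \<le> N + real n * N"
    using N[of 0] by (intro order_trans[OF norm_triangle_ineq4]) simp
  moreover have "0 \<le> N + real n * N" using \<open>N \<ge> 0\<close> by simp
  ultimately have "cmod (if odd n then x 0 - (\<Sum>i<n. of_real (\<beta> i) * x (Suc i)) else 0) \<le> N + real n * N"
    by simp
  then have "cmod (twist x n) \<le> N + (N + real n * N)"
    unfolding twist_def using N[of "Suc n"] by (intro order_trans[OF norm_triangle_ineq]) simp
  also have "\<dots> \<le> 2 * N * real (Suc n)"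
    using \<open>N \<ge> 0\<close> by (simp add: algebra_simps)
  finally show ?thesis by (simp add: N_def)
qed

lemma
  assumes x: "x \<in> square_summable" and z: "cmod z < 1"
  shows summable_twist: "summable (\<lambda>n. twist x n * z ^ n)"
    and twisted_series_bound: "cmod (\<Sum>n. twist x n * z ^ n) \<le> 2 * ip_norm l2_ip x / (1 - cmod z)\<^sup>2"
proof -
  \<comment> \<open>The majorant is the derivative of the geometric series.\<close>
  have "(\<lambda>n. 2 * ip_norm l2_ip x * (of_nat (Suc n) * cmod z ^ n)) sums
          (2 * ip_norm l2_ip x * (1 / (1 - cmod z)\<^sup>2))"
    using z by (intro sums_mult geometric_deriv_sums) simp
  note s = this
  have b: "cmod (twist x n * z ^ n) \<le> 2 * ip_norm l2_ip x * (of_nat (Suc n) * cmod z ^ n)" for n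
    using mult_right_mono[OF twist_bound[OF x, of n], of "cmod z ^ n"]
    by (simp add: norm_mult norm_power mult.assoc)
  show "summable (\<lambda>n. twist x n * z ^ n)"
    by (rule summable_comparison_test[OF _ sums_summable[OF s]]) (use b in blast)
  show "cmod (\<Sum>n. twist x n * z ^ n) \<le> 2 * ip_norm l2_ip x / (1 - cmod z)\<^sup>2"
    using norm_suminf_le[OF b sums_summable[OF s]] sums_unique[OF s] by simp
qed

lemma twisted_series_sums:
  "x \<in> square_summable \<Longrightarrow> cmod z < 1 \<Longrightarrow> (\<lambda>n. twist x n * z ^ n) sums twisted_series x z"
  using summable_twist by (simp add: twisted_series_def on_disc_def summable_sums)

lemma twist_unique:
  assumes x: "x \<in> square_summable"
    and a: "\<And>z. cmod z < 1 \<Longrightarrow> (\<lambda>n. a n * z ^ n) sums twisted_series x z"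
  shows "twist x n = a n"
proof -
  have "(\<lambda>n. (twist x n - a n) * z ^ n) sums 0" if "cmod z < 1" for z
    using sums_diff[OF twisted_series_sums[OF x that] a[OF that]] by (simp add: algebra_simps)
  from powser_eq_zero[of "\<lambda>n. twist x n - a n", OF this] show ?thesis by simp
qed

lemma twisted_series_eqI:
  assumes "\<And>z. cmod z < 1 \<Longrightarrow> (\<lambda>n. twist x n * z ^ n) sums f z"
  shows "twisted_series x = on_disc f"
  using assms by (auto simp: twisted_series_def on_disc_def sums_iff)

text \<open>For odd \<open>n > N\<close> the hypotheses say \<open>x (Suc n) = - x 0\<close>, so that square summability
  forces \<open>x 0 = 0\<close>.\<close>

lemma zero_if_twist_eventually_zero:
  assumes x: "x \<in> square_summable"
    and even: "\<And>n. even n \<Longrightarrow> twist x n = 0" and ev: "\<And>n. n > N \<Longrightarrow> twist x n = 0"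
  shows "x 0 = 0"
proof -
  have e: "x (Suc n) = 0" if "even n" for n
    using even[OF that] that by (simp add: twist_def)
  then have s: "of_real (\<beta> i) * x (Suc i) = 0" for i
    by (cases "even i") (auto simp: odd_zero)
  have "x (Suc (Suc (2 * n))) = - x 0" if "n > N" for n
    using ev[of "Suc (2 * n)"] that by (simp add: twist_def s add_eq_0_iff2)
  moreover have "(\<lambda>n. (cmod (x n))\<^sup>2) \<longlonglongrightarrow> 0"
    using x unfolding square_summable_def mem_Collect_eq by (rule summable_LIMSEQ_zero)
  then have "((\<lambda>n. (cmod (x n))\<^sup>2) \<circ> (\<lambda>n. Suc (Suc (2 * n)))) \<longlonglongrightarrow> 0"
    by (rule LIMSEQ_subseq_LIMSEQ) (auto simp: strict_mono_def)
  ultimately have "(\<lambda>n. (cmod (x 0))\<^sup>2) \<longlonglongrightarrow> 0"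
    by (elim Lim_transform_eventually) (auto intro!: eventually_mono[OF eventually_gt_at_top[of N]])
  then show ?thesis by (simp add: LIMSEQ_const_iff)
qed

text \<open>Injectivity of the map. Vanishing even coefficients remove the weighted sums, and then
  \<open>x 0 = 0\<close> reduces \<open>twist\<close> to a shift of coordinates.\<close>

lemma zero_if_twist_zero:
  assumes x: "x \<in> square_summable" and t: "\<And>n. twist x n = 0"
  shows "x = (\<lambda>i. 0)"
proof -
  have x0: "x 0 = 0" using zero_if_twist_eventually_zero[OF x t t] .
  have e: "x (Suc n) = 0" if "even n" for n
    using t[of n] that by (simp add: twist_def)
  then have s: "of_real (\<beta> i) * x (Suc i) = 0" for i
    by (cases "even i") (auto simp: odd_zero)
  have "x (Suc n) = 0" for n
    using t[of n] by (simp add: twist_def s x0 split: if_splits)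
  with x0 have "x i = 0" for i by (cases i) auto
  then show ?thesis by auto
qed

sublocale hol_embedding square_summable l2_ip twisted_series
proof (unfold_locales)
  show "l2.mcomplete" by (rule l2_complete)
  show "twisted_series x \<in> Hol_disc" if "x \<in> square_summable" for x
  proof -
    have "twisted_series x holomorphic_on ball 0 1"
      using twisted_series_sums[OF that]
      by (intro power_series_holomorphic[of 0 1 "twist x"]) simp
    then show ?thesis by (auto simp: Hol_disc_def twisted_series_def on_disc_def)
  qed
  show "twisted_series (\<lambda>i. x i + y i) = (\<lambda>z. twisted_series x z + twisted_series y z)"
    if "x \<in> square_summable" "y \<in> square_summable" for x y
  proof -
    have "twisted_series (\<lambda>i. x i + y i) = on_disc (\<lambda>z. twisted_series x z + twisted_series y z)"
      using sums_add[OF twisted_series_sums twisted_series_sums] that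
      by (intro twisted_series_eqI) (simp add: twist_add distrib_right)
    then show ?thesis by (auto simp: on_disc_def twisted_series_def)
  qed
  show "twisted_series (\<lambda>i. c * x i) = (\<lambda>z. c * twisted_series x z)"
    if "x \<in> square_summable" for c x
  proof -
    have "twisted_series (\<lambda>i. c * x i) = on_disc (\<lambda>z. c * twisted_series x z)"
      using sums_mult[OF twisted_series_sums] that
      by (intro twisted_series_eqI) (simp add: twist_scale mult.assoc)
    then show ?thesis by (auto simp: on_disc_def twisted_series_def)
  qed
  show "x = (\<lambda>i. 0)" if "x \<in> square_summable" "twisted_series x = (\<lambda>z. 0)" for x
    using twist_unique[OF that(1), of "\<lambda>n. 0"] that(2) by (intro zero_if_twist_zero that(1)) simp
  show "\<exists>C. \<forall>x\<in>square_summable. \<forall>z\<in>K. cmod (twisted_series x z) \<le> C * ip_norm l2_ip x"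
    if K: "compact K" "K \<subseteq> ball 0 1" for K
  proof (cases "K = {}")
    case False
    \<comment> \<open>A point of largest modulus in \<open>K\<close> makes the pointwise bound
      uniform on \<open>K\<close>.\<close>
    then obtain w where w: "w \<in> K" "\<forall>z\<in>K. cmod z \<le> cmod w"
      using continuous_attains_sup[OF K(1), of cmod] by (auto intro: continuous_intros)
    then have w1: "cmod w < 1" using K(2) by auto
    have "cmod (twisted_series x z) \<le> 2 / (1 - cmod w)\<^sup>2 * ip_norm l2_ip x"
      if x: "x \<in> square_summable" and z: "z \<in> K" for x z
    proof -
      have zw: "cmod z \<le> cmod w" "cmod z < 1" using w w1 z by auto
      have "cmod (twisted_series x z) \<le> 2 * ip_norm l2_ip x / (1 - cmod z)\<^sup>2"
        using twisted_series_bound[OF x zw(2)] zw by (simp add: twisted_series_def on_disc_def)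
      also have "\<dots> \<le> 2 * ip_norm l2_ip x / (1 - cmod w)\<^sup>2"
        using zw w1 ip_norm_l2_nonneg[OF x] by (intro divide_left_mono power_mono mult_pos_pos) auto
      finally show ?thesis by simp
    qed
    then show ?thesis by blast
  qed auto
qed

section \<open>Polynomials and monomials in the image\<close>

lemma twisted_series_polynomial:
  assumes "\<And>n. n > N \<Longrightarrow> twist x n = 0"
  shows "twisted_series x \<in> disc_polynomials"
proof -
  define p where "p = Poly (map (twist x) [0..<Suc N])"
  have p: "coeff p n = twist x n" for n
    using assms by (simp add: p_def nth_default_def del: upt_Suc)
  have deg: "degree p \<le> N"
    by (rule degree_le) (use assms in \<open>simp add: p\<close>)
  have "(\<lambda>n. twist x n * z ^ n) sums poly p z" for z
    unfolding poly_altdef p[symmetric] by (rule sums_finite) (auto simp: coeff_eq_0)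
  then have "twisted_series x = on_disc (poly p)"
    by (intro twisted_series_eqI)
  then show ?thesis by (auto simp: disc_polynomials_def)
qed

text \<open>This vector is the preimage of \<open>z^n\<close>. The unit entry at
  \<open>Suc n\<close> contributes \<open>\<beta> n\<close> to the weighted sums of all later odd
  coefficients, so entry 0 must be \<open>\<beta> n\<close>; the entries \<open>- \<beta> n\<close>
  undo its effect on the odd coefficients below \<open>n\<close>.\<close>

definition monomial_vector :: "nat \<Rightarrow> nat \<Rightarrow> complex" where
  "monomial_vector n i =
     (if i = 0 then of_real (\<beta> n) else if i = Suc n then 1
      else if i \<le> n \<and> even i then - of_real (\<beta> n) else 0)"

lemma monomial_vector_mem: "monomial_vector n \<in> square_summable"
  by (rule square_summable_finite[of "{..Suc n}"]) (auto simp: monomial_vector_def)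

lemma twist_monomial_vector: "twist (monomial_vector n) m = (if m = n then 1 else 0)"
proof -
  \<comment> \<open>An entry \<open>- \<beta> n\<close> stands at a coordinate \<open>Suc i\<close>
    with \<open>i\<close> odd, where \<open>\<beta> i = 0\<close>.\<close>
  have "of_real (\<beta> i) * monomial_vector n (Suc i) = (if i = n then of_real (\<beta> n) else 0)" for i
    by (cases "even i") (auto simp: monomial_vector_def odd_zero)
  then have "twist (monomial_vector n) m = monomial_vector n (Suc m) +
      (if odd m then monomial_vector n 0 - (if n < m then of_real (\<beta> n) else 0) else 0)"
    by (simp add: twist_def)
  then show ?thesis
    by (auto simp: monomial_vector_def odd_zero)
qed

lemma twisted_series_monomial_vector: "twisted_series (monomial_vector n) = on_disc (\<lambda>z. z ^ n)"
  using powser_sums_if[of n] by (intro twisted_series_eqI) (simp add: twist_monomial_vector)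

text \<open>Apart from the unit entry, at most \<open>n + 1\<close> entries are nonzero, each of
  modulus at most that of \<open>\<beta> n\<close>.\<close>

lemma norm_monomial: "ip_norm image_ip (on_disc (\<lambda>z. z ^ n)) \<le> sqrt (1 + (real n + 1) * (\<beta> n)\<^sup>2)"
proof -
  have "(\<Sum>i\<le>Suc n. (cmod (monomial_vector n i))\<^sup>2) \<le> (\<Sum>i\<le>n. (\<beta> n)\<^sup>2) + 1"
    unfolding sum.atMost_Suc
    by (intro add_mono sum_mono) (auto simp: monomial_vector_def)
  then have "ip_norm l2_ip (monomial_vector n) \<le> sqrt (1 + (real n + 1) * (\<beta> n)\<^sup>2)"
    by (subst l2_norm_finite[of "{..Suc n}"]) (auto simp: monomial_vector_def algebra_simps)
  then show ?thesis
    using image_norm_T[OF monomial_vector_mem] by (simp add: twisted_series_monomial_vector)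
qed

lemma polynomials_subset: "disc_polynomials \<subseteq> twisted_series ` square_summable"
proof
  fix f assume "f \<in> disc_polynomials"
  then obtain p where p: "f = on_disc (poly p)" by (auto simp: disc_polynomials_def)
  have "(\<lambda>z. \<Sum>i\<in>A. coeff p i * on_disc (\<lambda>z. z ^ i) z) \<in> twisted_series ` square_summable"
    if "finite A" for A
    using that
  proof (induction A rule: finite_induct)
    case empty
    then show ?case using image.zero_mem by simp
  next
    case (insert i A)
    have "on_disc (\<lambda>z. z ^ i) \<in> twisted_series ` square_summable"
      using monomial_vector_mem twisted_series_monomial_vector by (metis imageI)
    with insert show ?case by (simp add: image.add_mem image.scale_mem)
  qed
  moreover have "f = (\<lambda>z. \<Sum>i\<le>degree p. coeff p i * on_disc (\<lambda>z. z ^ i) z)"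
    by (auto simp: p on_disc_def poly_altdef)
  ultimately show "f \<in> twisted_series ` square_summable" by simp
qed

section \<open>Density of the polynomials\<close>

text \<open>Adding a multiple of \<open>\<beta>\<close>, cut off at \<open>N\<close>, to a finitely supported vector makes its
  series a polynomial, at a cost that tends to 0 because \<open>\<beta>\<close> is not square summable.\<close>

lemma approx_finite_support:
  assumes fin: "\<And>i. i > M \<Longrightarrow> x i = 0" and e: "e > 0"
  obtains y where "y \<in> square_summable" "twisted_series y \<in> disc_polynomials"
    "ip_norm l2_ip (\<lambda>i. x i - y i) < e"
proof -
  \<comment> \<open>Every odd coefficient of the series of \<open>x\<close> from index
    \<open>M\<close> on equals \<open>c\<close>; this constant tail has to be cancelled.\<close>
  define c where "c = x 0 - (\<Sum>i<M. of_real (\<beta> i) * x (Suc i))"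
  have c: "x 0 - (\<Sum>i<n. of_real (\<beta> i) * x (Suc i)) = c" if "n \<ge> M" for n
    unfolding c_def using that fin by (intro arg_cong2[of _ _ _ _ "(-)"] refl sum.mono_neutral_right) auto
  define S where "S N = (\<Sum>i<N. (\<beta> i)\<^sup>2)" for N
  \<comment> \<open>The correction will cost \<open>(cmod c)\<^sup>2 / S N\<close> in squared norm,
    which must be below \<open>e\<^sup>2\<close>. The summand 1 keeps \<open>S N\<close> positive
    when \<open>c = 0\<close>.\<close>
  obtain N0 where N0: "S N0 > (cmod c / e)\<^sup>2 + 1"
    using diverges summableI_nonneg_bounded[of "\<lambda>i. (\<beta> i)\<^sup>2" "(cmod c / e)\<^sup>2 + 1"]
    unfolding S_def by (meson not_le zero_le_power2)
  define N where "N = max M N0"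
  have "S N0 \<le> S N" unfolding S_def N_def by (intro sum_mono2) auto
  with N0 have SN: "S N > (cmod c / e)\<^sup>2" "S N > 0"
    by (auto intro: less_le_trans[of 0 "(cmod c / e)\<^sup>2 + 1"] simp: add_nonneg_pos)
  \<comment> \<open>Entry 0 is unchanged. The factor \<open>c / S N\<close> makes the weighted sum
    of the correction exactly \<open>c\<close>, and the index \<open>i - 1\<close> accounts for the
    shift of coordinates.\<close>
  define y where "y i = x i + (if 0 < i \<and> i \<le> N then c / of_real (S N) * of_real (\<beta> (i - 1)) else 0)" for i
  have y: "y \<in> square_summable"
    by (rule square_summable_finite[of "{..N}"]) (auto simp: y_def fin N_def)
  have "twist y n = 0" if "n > N" for n
  proof -
    have "(\<Sum>i<n. of_real (\<beta> i) * y (Suc i)) =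
            (\<Sum>i<n. of_real (\<beta> i) * x (Suc i)) + (\<Sum>i<n. if i < N then c / of_real (S N) * of_real ((\<beta> i)\<^sup>2) else 0)"
      unfolding sum.distrib[symmetric]
      by (intro sum.cong) (auto simp: y_def algebra_simps power2_eq_square)
    also have "(\<Sum>i<n. if i < N then c / of_real (S N) * of_real ((\<beta> i)\<^sup>2) else 0) =
                 (\<Sum>i<N. c / of_real (S N) * of_real ((\<beta> i)\<^sup>2))"
      using that by (intro sum.mono_neutral_cong_right) auto
    also have "\<dots> = c"
      using SN(2) unfolding sum_distrib_left[symmetric] of_real_sum[symmetric] S_def[symmetric] by simp
    finally have "y 0 - (\<Sum>i<n. of_real (\<beta> i) * y (Suc i)) = 0"
      using c[of n] that by (simp add: y_def N_def algebra_simps)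
    moreover have "y (Suc n) = 0"
      using that by (simp add: y_def fin N_def le_max_iff_disj)
    ultimately show ?thesis by (simp add: twist_def)
  qed
  then have "twisted_series y \<in> disc_polynomials" by (rule twisted_series_polynomial)
  moreover have "ip_norm l2_ip (\<lambda>i. x i - y i) < e"
  proof -
    have "(\<Sum>i\<in>{1..N}. (cmod (x i - y i))\<^sup>2) = (\<Sum>i<N. (cmod c / S N)\<^sup>2 * (\<beta> i)\<^sup>2)"
      by (rule sum.reindex_bij_witness[of _ Suc "\<lambda>i. i - 1"])
        (use SN in \<open>auto simp: y_def norm_mult norm_divide power_mult_distrib power_divide\<close>)
    also have "\<dots> = (cmod c)\<^sup>2 / S N"
      using SN(2) unfolding sum_distrib_left[symmetric] S_def[symmetric]
      by (simp add: power_divide power2_eq_square)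
    also have "\<dots> < e\<^sup>2"
      using SN e by (simp add: power_divide field_simps)
    finally have "sqrt (\<Sum>i\<in>{1..N}. (cmod (x i - y i))\<^sup>2) < e"
      using e by (metis less_imp_le real_sqrt_less_mono real_sqrt_abs abs_of_nonneg)
    then show ?thesis
      by (subst l2_norm_finite[of "{1..N}"]) (auto simp: y_def)
  qed
  ultimately show thesis using y that by blast
qed

text \<open>Half of the error is spent on truncating \<open>x\<close> to finite support, the other
  half on \<open>approx_finite_support\<close>.\<close>

lemma polynomials_dense: "ip_dense_in (twisted_series ` square_summable) image_ip disc_polynomials
    (twisted_series ` square_summable)"
  unfolding ip_dense_in_def image.metric_closure_of
proof (clarsimp simp: image.in_mball)
  fix x and r :: real assume x: "x \<in> square_summable" and r: "r > 0"
  have "(\<lambda>N. \<Sum>i. (cmod (x (i + N)))\<^sup>2) \<longlonglongrightarrow> 0"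
    using x by (intro suminf_exist_split2) (simp add: square_summable_def)
  then have "eventually (\<lambda>N. (\<Sum>i. (cmod (x (i + N)))\<^sup>2) < (r / 2)\<^sup>2) sequentially"
    by (rule order_tendstoD) (use r in simp)
  then obtain N where N: "(\<Sum>i. (cmod (x (i + N)))\<^sup>2) < (r / 2)\<^sup>2"
    by (auto simp: eventually_sequentially)
  define x' where "x' i = (if i < N then x i else 0)" for i
  have x': "x' \<in> square_summable"
    by (rule square_summable_finite[of "{..<N}"]) (auto simp: x'_def)
  obtain y where y: "y \<in> square_summable" "twisted_series y \<in> disc_polynomials"
    "ip_norm l2_ip (\<lambda>i. x' i - y i) < r / 2"
    using approx_finite_support[of N x' "r / 2"] r by (auto simp: x'_def)
  have "ip_norm l2_ip (\<lambda>i. x i - x' i) < r / 2"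
  proof -
    have d: "(\<lambda>i. x i - x' i) \<in> square_summable" by (rule l2.diff_mem[OF x x'])
    have "(\<Sum>i. (cmod (x i - x' i))\<^sup>2) = (\<Sum>i. (cmod (x (i + N)))\<^sup>2)"
      using d suminf_split_initial_segment[of "\<lambda>i. (cmod (x i - x' i))\<^sup>2" N]
      by (simp add: square_summable_def x'_def)
    with N have "sqrt (\<Sum>i. (cmod (x i - x' i))\<^sup>2) < sqrt ((r / 2)\<^sup>2)"
      by (intro real_sqrt_less_mono) simp
    then show ?thesis using r by (simp add: l2_norm d)
  qed
  with y(3) have "ip_dist square_summable l2_ip x y < r"
    using l2.triangle[OF x x' y(1)] by (simp add: ip_dist_def x x' y)
  then have "ip_dist (twisted_series ` square_summable) image_ip (twisted_series x) (twisted_series y) < r"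
    by (simp add: image_dist_T x y)
  with y show "\<exists>f\<in>disc_polynomials. f \<in> twisted_series ` square_summable \<and>
      ip_dist (twisted_series ` square_summable) image_ip (twisted_series x) f < r"
    by blast
qed

section \<open>Odd functions and the failure of density\<close>

definition gap_vector :: "nat \<Rightarrow> complex" where
  "gap_vector i = (if i = 0 then 1 else 0)"

lemma gap_vector_mem: "gap_vector \<in> square_summable"
  by (rule square_summable_finite[of "{0}"]) (auto simp: gap_vector_def)

text \<open>Oddness says that \<open>f z\<close> and \<open>- f (- z)\<close> agree; their
  coefficients differ exactly by a sign at even indices.\<close>

lemma odd_on_disc_iff_twist:
  assumes x: "x \<in> square_summable"
  shows "odd_on_disc (twisted_series x) \<longleftrightarrow> (\<forall>n. even n \<longrightarrow> twist x n = 0)"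
proof
  assume o: "odd_on_disc (twisted_series x)"
  have "(\<lambda>n. (- ((- 1) ^ n) * twist x n) * z ^ n) sums twisted_series x z" if "cmod z < 1" for z
  proof -
    have "(\<lambda>n. - (twist x n * (- z) ^ n)) sums - twisted_series x (- z)"
      using twisted_series_sums[OF x, of "- z"] that by (intro sums_minus) simp
    then show ?thesis
      using o that by (simp add: odd_on_disc_def power_minus[of z] mult_ac)
  qed
  from twist_unique[OF x this] have "twist x n = - ((- 1) ^ n) * twist x n" for n .
  then have "twist x n = - twist x n" if "even n" for n
    using that by (metis mult_minus1 neg_one_even_power)
  then show "\<forall>n. even n \<longrightarrow> twist x n = 0" by (simp add: complex_eq_iff)
next
  assume e: "\<forall>n. even n \<longrightarrow> twist x n = 0"
  show "odd_on_disc (twisted_series x)"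
    unfolding odd_on_disc_def
  proof
    fix z :: complex assume z: "z \<in> ball 0 1"
    have "(\<lambda>n. - (twist x n * z ^ n)) sums - twisted_series x z"
      using twisted_series_sums[OF x, of z] z by (intro sums_minus) simp
    moreover have "- (twist x n * z ^ n) = twist x n * (- z) ^ n" for n
      by (cases "even n") (use e in auto)
    ultimately show "twisted_series x (- z) = - twisted_series x z"
      using twisted_series_sums[OF x, of "- z"] z by (simp add: sums_unique2)
  qed
qed

text \<open>Coordinate 0 is dominated by the norm. It vanishes on the preimage of every odd
  polynomial but is 1 at \<open>gap_vector\<close>, so the distance between them is at least
  1.\<close>

lemma odd_polynomials_not_dense:
  "\<not> ip_dense_in (twisted_series ` square_summable) image_ip {p \<in> disc_polynomials. odd_on_disc p}
      {f \<in> twisted_series ` square_summable. odd_on_disc f}"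
proof
  let ?h = "twisted_series gap_vector"
  assume "ip_dense_in (twisted_series ` square_summable) image_ip {p \<in> disc_polynomials. odd_on_disc p}
      {f \<in> twisted_series ` square_summable. odd_on_disc f}"
  moreover have "odd_on_disc ?h"
    by (simp add: odd_on_disc_iff_twist gap_vector_mem) (simp add: twist_def gap_vector_def)
  ultimately have "?h \<in> image.mtopology closure_of {p \<in> disc_polynomials. odd_on_disc p}"
    unfolding ip_dense_in_def using gap_vector_mem by blast
  then obtain p where p: "p \<in> disc_polynomials" "odd_on_disc p" "p \<in> image.mball ?h 1"
    unfolding image.metric_closure_of by (auto dest: spec[of _ 1])
  then obtain q where q: "p = on_disc (poly q)" by (auto simp: disc_polynomials_def)
  from p obtain y where y: "y \<in> square_summable" "p = twisted_series y" by (auto simp: image.in_mball)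
  have "(\<lambda>n. coeff q n * z ^ n) sums twisted_series y z" if "cmod z < 1" for z
  proof -
    have "(\<lambda>n. coeff q n * z ^ n) sums poly q z"
      unfolding poly_altdef by (rule sums_finite) (auto simp: coeff_eq_0)
    moreover have "twisted_series y z = poly q z"
      using that by (simp add: y(2)[symmetric] q on_disc_def)
    ultimately show ?thesis by simp
  qed
  from twist_unique[OF y(1) this] have t: "twist y n = coeff q n" for n .
  have "y 0 = 0"
  proof (rule zero_if_twist_eventually_zero[OF y(1)])
    show "twist y n = 0" if "even n" for n
      using p(2) that y by (simp add: odd_on_disc_iff_twist)
    show "twist y n = 0" if "n > degree q" for n
      using that by (simp add: t coeff_eq_0)
  qed
  then have "1 \<le> ip_norm l2_ip (\<lambda>i. gap_vector i - y i)"
    using cmod_le_l2_norm[OF l2.diff_mem[OF gap_vector_mem y(1)], of 0] by (simp add: gap_vector_def)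
  moreover have "ip_dist square_summable l2_ip gap_vector y < 1"
    using p(3) y gap_vector_mem by (simp only: image.in_mball image_dist_T)
  ultimately show False by (simp add: ip_dist_def gap_vector_mem y)
qed

end

section \<open>Choice of the weights and conclusion\<close>

text \<open>Along even indices the squared weights are
  \<open>\<delta>\<^sup>2 / (2 * n + 1)\<close>, comparable to the harmonic series.\<close>

lemma gap_weights_harmonic:
  assumes "0 < \<delta>" "\<delta> \<le> 1"
  shows "gap_weights (\<lambda>i. if even i then \<delta> / sqrt (real i + 1) else 0)"
proof
  show "\<bar>if even i then \<delta> / sqrt (real i + 1) else 0\<bar> \<le> 1" for i
  proof -
    have "1 \<le> sqrt (real i + 1)" by simp
    then have "\<delta> \<le> sqrt (real i + 1)" using assms by linarith
    then show ?thesis using assms by (simp add: divide_le_eq)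
  qed
  show "\<not> summable (\<lambda>i. (if even i then \<delta> / sqrt (real i + 1) else 0)\<^sup>2)"
  proof
    assume "summable (\<lambda>i. (if even i then \<delta> / sqrt (real i + 1) else 0)\<^sup>2)"
    then have "summable (\<lambda>n. (if even (2 * n) then \<delta> / sqrt (real (2 * n) + 1) else 0)\<^sup>2)"
      by (rule summable_reindex[where g = "\<lambda>n. 2 * n", unfolded o_def]) (auto simp: inj_on_def)
    then have "summable (\<lambda>n. \<delta>\<^sup>2 / (2 * real n + 1))"
      by (simp add: power_divide)
    \<comment> \<open>The factor makes the terms \<open>2 / (2 * n + 1)\<close>, which dominate
      \<open>1 / (n + 1)\<close>.\<close>
    then have "summable (\<lambda>n. 2 / \<delta>\<^sup>2 * (\<delta>\<^sup>2 / (2 * real n + 1)))"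
      by (rule summable_mult)
    then have "summable (\<lambda>n. inverse (real (Suc n)))"
      by (rule summable_comparison_test[rotated])
        (use assms in \<open>auto intro!: exI[of _ 0] simp: field_simps\<close>)
    then show False
      using not_summable_harmonic by (subst (asm) summable_Suc_iff) blast
  qed
qed auto

text \<open>Each positive term \<open>1 / \<omega> n\<close> is at most the sum of the series, so
  the reciprocals of the terms stay away from 0.\<close>

lemma bounded_below_if_summable_inverse:
  fixes \<omega> :: "nat \<Rightarrow> real"
  assumes pos: "\<And>n. 0 < \<omega> n" and s: "summable (\<lambda>n. 1 / \<omega> n)"
  obtains \<delta> where "0 < \<delta>" "\<delta> \<le> 1" "\<And>n. \<delta> \<le> \<omega> n"
proof -
  \<comment> \<open>Adding 1 gives \<open>1 / S \<le> 1\<close>, as the bound on the weights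
    requires.\<close>
  define S where "S = 1 + (\<Sum>n. 1 / \<omega> n)"
  have "1 / \<omega> n \<le> (\<Sum>n. 1 / \<omega> n)" for n
    using sum_le_suminf[OF s, of "{n}"] pos by (simp add: less_imp_le)
  then have S: "1 / \<omega> n \<le> S" for n by (simp add: S_def add_increasing)
  have "S \<ge> 1" using suminf_nonneg[OF s] pos by (simp add: S_def less_imp_le)
  show thesis
  proof
    show "0 < 1 / S" "1 / S \<le> 1" using \<open>S \<ge> 1\<close> by auto
    show "1 / S \<le> \<omega> n" for n using S[of n] pos[of n] \<open>S \<ge> 1\<close> by (simp add: field_simps)
  qed
qed

theorem theorem1p1:
  shows "(\<exists>H ip. hilbert_hol_space H ip
            \<and> disc_polynomials \<subseteq> H
            \<and> ip_dense_in H ip disc_polynomials H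
            \<and> \<not> ip_dense_in H ip {p \<in> disc_polynomials. odd_on_disc p} {f \<in> H. odd_on_disc f})
       \<and> (\<forall>\<omega> :: nat \<Rightarrow> real. (\<forall>n. 0 < \<omega> n) \<and> summable (\<lambda>n. 1 / \<omega> n) \<longrightarrow>
           (\<exists>H ip. hilbert_hol_space H ip
            \<and> disc_polynomials \<subseteq> H
            \<and> ip_dense_in H ip disc_polynomials H
            \<and> \<not> ip_dense_in H ip {p \<in> disc_polynomials. odd_on_disc p} {f \<in> H. odd_on_disc f}
            \<and> (\<forall>n. ip_norm ip (on_disc (\<lambda>z. z ^ n)) \<le> 1 + \<omega> n)))"
    (is "(\<exists>H ip. ?space H ip \<and> ?poly H \<and> ?dense H ip \<and> ?gap H ip) \<and> ?R")
proof -
  have *: "\<exists>H ip. ?space H ip \<and> ?poly H \<and> ?dense H ip \<and> ?gap H ip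
            \<and> (\<forall>n. ip_norm ip (on_disc (\<lambda>z. z ^ n)) \<le> 1 + \<omega> n)"
    if \<omega>: "\<And>n. 0 < \<omega> n" "summable (\<lambda>n. 1 / \<omega> n)" for \<omega> :: "nat \<Rightarrow> real"
  proof -
    obtain \<delta> where \<delta>: "0 < \<delta>" "\<delta> \<le> 1" "\<And>n. \<delta> \<le> \<omega> n"
      using bounded_below_if_summable_inverse[OF \<omega>] by blast
    define \<beta> where "\<beta> = (\<lambda>i. if even i then \<delta> / sqrt (real i + 1) else 0)"
    interpret gap_weights \<beta>
      unfolding \<beta>_def by (rule gap_weights_harmonic[OF \<delta>(1,2)])
    have "ip_norm image_ip (on_disc (\<lambda>z. z ^ n)) \<le> 1 + \<omega> n" for n
    proof -
      have "(real n + 1) * (\<beta> n)\<^sup>2 \<le> \<delta>\<^sup>2"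
        by (simp add: \<beta>_def power_divide)
      then have "1 + (real n + 1) * (\<beta> n)\<^sup>2 \<le> (1 + \<delta>)\<^sup>2"
        using \<delta>(1) by (simp add: power2_sum)
      then have "sqrt (1 + (real n + 1) * (\<beta> n)\<^sup>2) \<le> 1 + \<delta>"
        using \<delta>(1) by (intro real_le_lsqrt) auto
      with norm_monomial[of n] \<delta>(3)[of n] show ?thesis by linarith
    qed
    then show ?thesis
      using image_hilbert_hol_space polynomials_subset polynomials_dense odd_polynomials_not_dense
      by blast
  qed
  \<comment> \<open>The existence claim without norm bounds is the case
    \<open>\<omega> n = 2 ^ n\<close>.\<close>
  have "summable (\<lambda>n. 1 / 2 ^ n :: real)"
    using summable_geometric[of "1 / 2 :: real"] by (simp add: power_one_over)
  then have "\<exists>H ip. ?space H ip \<and> ?poly H \<and> ?dense H ip \<and> ?gap H ip"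
    using *[of "\<lambda>n. 2 ^ n"] by auto
  with * show ?thesis by blast
qed

end
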